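(* Let $\mathcal{T}=\{\mathcal{T}_s\}_{s\in\mathcal{S}}$ be a finite collection of GLS IFSs with digit set $\mathcal{D}$, and let $\alpha=(\alpha_d)_{d\in\mathcal{D}}$ be a frequency vector such that for each $s\in\mathcal{S}$ there exists $b\in\mathcal{B}_s$ with $\alpha_{(s,b)}>0$. Then $$\Omega_{\mathcal{T}}(\alpha)=\left\{\omega=(\omega_n)_{n\in\mathbb{N}}\in\mathcal{S}^{\mathbb{N}}\,:\,\lim_{n\to+\infty}\frac{\#\{1\le k\le n\,:\,\omega_k=s\}}{n}=\alpha_s\ \text{ for all } s\in\mathcal{S}\right\}.$$ In particular, $\Omega_{\mathcal{T}}(\alpha)\neq\emptyset$.
   Context: $\mathbb{N}=\{1,2,\dots\}$ and $|U|$ denotes the diameter of $U\subseteq\mathbb{R}$. $\mathcal{S}$ is a finite set. For each $s\in\mathcal{S}$, $\mathcal{T}_s=\{f_{s,b}:[0,1]\to[0,1]\}_{b\in\mathcal{B}_s}$ is a GLS IFS, meaning: the index set $\mathcal{B}_s$ is countable, and is taken to be $\{1,2,\dots,B_s\}$ for some $B_s\in\mathbb{N}$ if it is finite and $\mathbb{N}$ otherwise; each $f_{s,b}$ is an affine contraction, with contraction ratio $N_{s,b}^{-1}=|f_{s,b}([0,1])|\in(0,1)$; $\mathcal{T}_s$ satisfies the open set condition (there is a non-empty open $U\subseteq[0,1]$ with $f_{s,b}(U)\subseteq U$ for all $b$ and $f_{s,b}(U)\cap f_{s,b'}(U)=\emptyset$ for $b\neq b'$); and $\sum_{b\in\mathcal{B}_s}|f_{s,b}([0,1])|=1$.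 The digit set is $\mathcal{D}=\{(s,b):s\in\mathcal{S},\,b\in\mathcal{B}_s\}$. A frequency vector $\alpha=(\alpha_d)_{d\in\mathcal{D}}$ is a probability vector: $\alpha_d\ge0$ and $\sum_{d\in\mathcal{D}}\alpha_d=1$. Put $\alpha_s=\sum_{b\in\mathcal{B}_s}\alpha_{(s,b)}$. For $\omega=(\omega_n)_{n\in\mathbb{N}}\in\mathcal{S}^{\mathbb{N}}$ let $\mathcal{B}_\omega^{\mathbb{N}}=\{(b_n)_{n\in\mathbb{N}}: b_k\in\mathcal{B}_{\omega_k}\ \forall k\in\mathbb{N}\}$ and let $\pi_\omega:\mathcal{B}_\omega^{\mathbb{N}}\to[0,1]$ map $(b_n)_{n\in\mathbb{N}}$ to the unique point of $\bigcap_{n\in\mathbb{N}} f_{\omega_1,b_1}\circ\cdots\circ f_{\omega_n,b_n}([0,1])$. Set $$E_\omega(\alpha)=\left\{(b_n)_{n\in\mathbb{N}}\in\mathcal{B}_\omega^{\mathbb{N}}:\lim_{n\to+\infty}\frac{\#\{1\le k\le n:(\omega_k,b_k)=d\}}{n}=\alpha_d\ \text{ for all } d\in\mathcal{D}\right\},$$ $F_{\mathcal{T},\omega}(\alpha)=\pi_\omega(E_\omega(\alpha))$ and $\Omega_{\mathcal{T}}(\alpha)=\{\omega\in\mathcal{S}^{\mathbb{N}}:F_{\mathcal{T},\omega}(\alpha)\neq\emptyset\}$. *)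

theory Defs
  imports "HOL-Analysis.Analysis"
begin

text \<open>
  The positive integers are \<open>{1..} :: nat set\<close>, and a sequence indexed by them is an extensional
  function on \<open>{1..}\<close>, so that distinct functions are distinct sequences.
  A self-map of \<open>[0,1]\<close> is a function \<open>real \<Rightarrow> real\<close> of which only the values on
  \<open>{0..1}\<close> matter.
\<close>

definition affine_contraction :: "real \<Rightarrow> (real \<Rightarrow> real) \<Rightarrow> bool" where
  "affine_contraction \<rho> g \<longleftrightarrow>
     0 < \<rho> \<and> \<rho> < 1 \<and> g ` {0..1} \<subseteq> {0..1} \<and>
     (\<exists>a c. \<bar>a\<bar> = \<rho> \<and> (\<forall>x\<in>{0..1}. g x = a * x + c))"

definition open_set_condition :: "nat set \<Rightarrow> (nat \<Rightarrow> real \<Rightarrow> real) \<Rightarrow> bool" where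
  "open_set_condition B g \<longleftrightarrow>
     (\<exists>U. open U \<and> U \<noteq> {} \<and> U \<subseteq> {0..1} \<and>
        (\<forall>b\<in>B. g b ` U \<subseteq> U) \<and>
        (\<forall>b\<in>B. \<forall>b'\<in>B. b \<noteq> b' \<longrightarrow> g b ` U \<inter> g b' ` U = {}))"

definition GLS_IFS :: "nat set \<Rightarrow> (nat \<Rightarrow> real \<Rightarrow> real) \<Rightarrow> bool" where
  "GLS_IFS B g \<longleftrightarrow>
     ((\<exists>m\<ge>1. B = {1..m}) \<or> B = {1..}) \<and>
     (\<forall>b\<in>B. affine_contraction (diameter (g b ` {0..1})) (g b)) \<and>
     open_set_condition B g \<and>
     ((\<lambda>b. diameter (g b ` {0..1})) has_sum 1) B"

definition digits :: "'s set \<Rightarrow> ('s \<Rightarrow> nat set) \<Rightarrow> ('s \<times> nat) set" where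
  "digits S B = (SIGMA s:S. B s)"

definition frequency_vector :: "'d set \<Rightarrow> ('d \<Rightarrow> real) \<Rightarrow> bool" where
  "frequency_vector D \<alpha> \<longleftrightarrow> (\<forall>d\<in>D. 0 \<le> \<alpha> d) \<and> (\<alpha> has_sum 1) D"

definition symbol_weight :: "('s \<Rightarrow> nat set) \<Rightarrow> ('s \<times> nat \<Rightarrow> real) \<Rightarrow> 's \<Rightarrow> real" where
  "symbol_weight B \<alpha> s = (\<Sum>\<^sub>\<infinity>b\<in>B s. \<alpha> (s, b))"

definition has_frequency :: "(nat \<Rightarrow> 'd) \<Rightarrow> 'd \<Rightarrow> real \<Rightarrow> bool" where
  "has_frequency x d p \<longleftrightarrow>
     (\<lambda>n. real (card {k. 1 \<le> k \<and> k \<le> n \<and> x k = d}) / real n) \<longlonglongrightarrow> p"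

definition symbol_seqs :: "'s set \<Rightarrow> (nat \<Rightarrow> 's) set" where
  "symbol_seqs S = {1..} \<rightarrow>\<^sub>E S"

definition branch_seqs :: "('s \<Rightarrow> nat set) \<Rightarrow> (nat \<Rightarrow> 's) \<Rightarrow> (nat \<Rightarrow> nat) set" where
  "branch_seqs B \<omega> = (\<Pi>\<^sub>E k\<in>{1..}. B (\<omega> k))"

primrec branch_comp ::
  "('s \<Rightarrow> nat \<Rightarrow> real \<Rightarrow> real) \<Rightarrow> (nat \<Rightarrow> 's) \<Rightarrow> (nat \<Rightarrow> nat) \<Rightarrow> nat \<Rightarrow> real \<Rightarrow> real" where
  "branch_comp f \<omega> b 0 = id"
| "branch_comp f \<omega> b (Suc n) = branch_comp f \<omega> b n \<circ> f (\<omega> (Suc n)) (b (Suc n))"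

definition coding_map ::
  "('s \<Rightarrow> nat \<Rightarrow> real \<Rightarrow> real) \<Rightarrow> (nat \<Rightarrow> 's) \<Rightarrow> (nat \<Rightarrow> nat) \<Rightarrow> real" where
  "coding_map f \<omega> b = (THE x. x \<in> (\<Inter>n\<in>{1..}. branch_comp f \<omega> b n ` {0..1}))"

definition freq_branch_seqs ::
  "'s set \<Rightarrow> ('s \<Rightarrow> nat set) \<Rightarrow> ('s \<times> nat \<Rightarrow> real) \<Rightarrow> (nat \<Rightarrow> 's) \<Rightarrow> (nat \<Rightarrow> nat) set" where
  "freq_branch_seqs S B \<alpha> \<omega> =
     {b \<in> branch_seqs B \<omega>. \<forall>d\<in>digits S B. has_frequency (\<lambda>k. (\<omega> k, b k)) d (\<alpha> d)}"

definition freq_set ::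
  "'s set \<Rightarrow> ('s \<Rightarrow> nat set) \<Rightarrow> ('s \<Rightarrow> nat \<Rightarrow> real \<Rightarrow> real) \<Rightarrow> ('s \<times> nat \<Rightarrow> real) \<Rightarrow>
     (nat \<Rightarrow> 's) \<Rightarrow> real set" where
  "freq_set S B f \<alpha> \<omega> = coding_map f \<omega> ` freq_branch_seqs S B \<alpha> \<omega>"

definition Omega ::
  "'s set \<Rightarrow> ('s \<Rightarrow> nat set) \<Rightarrow> ('s \<Rightarrow> nat \<Rightarrow> real \<Rightarrow> real) \<Rightarrow> ('s \<times> nat \<Rightarrow> real) \<Rightarrow>
     (nat \<Rightarrow> 's) set" where
  "Omega S B f \<alpha> = {\<omega> \<in> symbol_seqs S. freq_set S B f \<alpha> \<omega> \<noteq> {}}"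

end

theory Submission
  imports Defs
begin

text \<open>
  The coding map plays no role: the set in question is an image, so it is nonempty iff some branch
  sequence has the prescribed digit frequencies. If one exists, Fatou's inequality bounds the lower
  frequency of each symbol from below by its weight; the weights sum to 1 over finitely many
  symbols, so these bounds are attained. Conversely, every probability vector \<open>p\<close> on the naturals is
  the frequency vector of a sequence built greedily: at time \<open>n\<close> choose the least digit \<open>d\<close> that has
  occurred fewer than \<open>n * p d\<close> times. Being behind schedule bounds each count from above by
  \<open>n * p d + 1\<close>; being least bounds the number of digits below any \<open>M\<close> from below by
  \<open>n * (\<Sum>d<M. p d)\<close>, so no frequency escapes to infinity.
\<close>

section \<open>Greedy sequences over the naturals\<close>

text \<open>Time starts at 0: \<open>c\<close> holds the counts after \<open>n\<close> choices and
  the pick is choice number \<open>Suc n\<close>, hence the factor \<open>Suc n\<close>.\<close>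

definition greedy_pick :: "(nat \<Rightarrow> real) \<Rightarrow> nat \<Rightarrow> (nat \<Rightarrow> nat) \<Rightarrow> nat" where
  "greedy_pick p n c = (LEAST d. real (c d) < real (Suc n) * p d)"

primrec greedy_count :: "(nat \<Rightarrow> real) \<Rightarrow> nat \<Rightarrow> nat \<Rightarrow> nat" where
  "greedy_count p 0 = (\<lambda>_. 0)"
| "greedy_count p (Suc n) =
     (let c = greedy_count p n; d = greedy_pick p n c in c(d := Suc (c d)))"

definition greedy_seq :: "(nat \<Rightarrow> real) \<Rightarrow> nat \<Rightarrow> nat" where
  "greedy_seq p n = greedy_pick p n (greedy_count p n)"

lemma greedy_count_Suc:
  "greedy_count p (Suc n) d = greedy_count p n d + (if greedy_seq p n = d then 1 else 0)"
  by (simp add: Let_def greedy_seq_def)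

lemma greedy_count_eq_card: "greedy_count p n d = card {k. k < n \<and> greedy_seq p k = d}"
proof (induction n)
  case (Suc n)
  have "{k. k < Suc n \<and> greedy_seq p k = d} =
      (if greedy_seq p n = d then insert n {k. k < n \<and> greedy_seq p k = d}
       else {k. k < n \<and> greedy_seq p k = d})"
    by (auto simp: less_Suc_eq)
  then show ?case
    using Suc by (simp add: greedy_count_Suc del: greedy_count.simps)
qed simp

lemma sum_greedy_count_Suc:
  "(\<Sum>d<M. greedy_count p (Suc n) d) =
     (\<Sum>d<M. greedy_count p n d) + (if greedy_seq p n < M then 1 else 0)"
  by (simp add: greedy_count_Suc sum.distrib del: greedy_count.simps)

lemma sum_greedy_count_le: "(\<Sum>d<M. greedy_count p n d) \<le> n"
proof (induction n)
  case (Suc n)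
  then show ?case by (simp add: sum_greedy_count_Suc del: greedy_count.simps)
qed simp

context
  fixes p :: "nat \<Rightarrow> real"
  assumes nonneg: "\<And>d. 0 \<le> p d" and p_sums: "p sums 1"
begin

text \<open>If no digit were behind schedule, the counts would add up to at least
  \<open>Suc n\<close>, but only \<open>n\<close> digits have been chosen. The support of
  \<open>p\<close> may be infinite, so finite parts are compared and \<open>M\<close> tends to
  infinity.\<close>

lemma greedy_pick_exists: "\<exists>d. real (greedy_count p n d) < real (Suc n) * p d"
proof (rule ccontr)
  assume "\<not> ?thesis"
  then have le: "real (Suc n) * p d \<le> real (greedy_count p n d)" for d
    by (simp add: not_less)
  have "real (Suc n) * (\<Sum>d<M. p d) \<le> real n" for M
  proof -
    have "real (Suc n) * (\<Sum>d<M. p d) \<le> (\<Sum>d<M. real (greedy_count p n d))"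
      unfolding sum_distrib_left by (rule sum_mono) (rule le)
    also have "\<dots> \<le> real n"
      using sum_greedy_count_le[of p n M] by (simp flip: of_nat_sum)
    finally show ?thesis .
  qed
  moreover have "(\<lambda>M. real (Suc n) * (\<Sum>d<M. p d)) \<longlonglongrightarrow> real (Suc n) * 1"
    using p_sums unfolding sums_def by (rule tendsto_mult_left)
  ultimately have "real (Suc n) * 1 \<le> real n"
    by (intro LIMSEQ_le_const2) auto
  then show False by simp
qed

lemma greedy_seq_less: "real (greedy_count p n (greedy_seq p n)) < real (Suc n) * p (greedy_seq p n)"
  unfolding greedy_seq_def greedy_pick_def by (rule LeastI_ex) (rule greedy_pick_exists)

text \<open>A digit of weight 0 is never behind schedule. This will keep the choices inside a coded
  digit set.\<close>

lemma greedy_seq_pos: "0 < p (greedy_seq p n)"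
proof -
  have "0 < real (Suc n) * p (greedy_seq p n)"
    using greedy_seq_less[of n] by (rule le_less_trans[rotated]) simp
  then show ?thesis by (simp add: zero_less_mult_iff)
qed

lemma below_greedy_seq:
  "d < greedy_seq p n \<Longrightarrow> real (Suc n) * p d \<le> real (greedy_count p n d)"
  unfolding greedy_seq_def greedy_pick_def by (meson not_less not_less_Least)

text \<open>A count grows only when it lies strictly below the schedule of the next time, so it gets
  ahead by at most 1.\<close>

lemma greedy_count_upper: "real (greedy_count p n d) \<le> real n * p d + 1"
proof (induction n)
  case (Suc n)
  show ?case
  proof (cases "greedy_seq p n = d")
    case True
    then show ?thesis
      using greedy_seq_less[of n] by (simp add: greedy_count_Suc del: greedy_count.simps)
  next
    case False
    then show ?thesis
      using Suc nonneg[of d]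
      by (simp add: greedy_count_Suc algebra_simps del: greedy_count.simps)
  qed
qed simp

lemma sum_greedy_count_lower: "real n * (\<Sum>d<M. p d) \<le> (\<Sum>d<M. real (greedy_count p n d))"
proof (induction n)
  case (Suc n)
  show ?case
  proof (cases "greedy_seq p n < M")
    case True
    \<comment> \<open>The left side grows by at most 1 and the right side by exactly 1.\<close>
    have "(\<Sum>d<M. p d) \<le> 1"
      using sum_le_suminf[of p "{..<M}"] p_sums nonneg by (auto simp: sums_iff)
    then have "real (Suc n) * (\<Sum>d<M. p d) \<le> real n * (\<Sum>d<M. p d) + 1"
      by (simp add: algebra_simps)
    also have "\<dots> \<le> (\<Sum>d<M. real (greedy_count p n d)) + 1"
      using Suc by simp
    also have "\<dots> = (\<Sum>d<M. real (greedy_count p (Suc n) d))"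
      using True sum_greedy_count_Suc[of p n M]
      by (simp flip: of_nat_sum del: greedy_count.simps)
    finally show ?thesis .
  next
    case False
    \<comment> \<open>By minimality of the pick, every digit below \<open>M\<close> already meets
      its schedule for time \<open>Suc n\<close>.\<close>
    have "real (Suc n) * (\<Sum>d<M. p d) \<le> (\<Sum>d<M. real (greedy_count p n d))"
      unfolding sum_distrib_left using False by (intro sum_mono below_greedy_seq) auto
    also have "\<dots> = (\<Sum>d<M. real (greedy_count p (Suc n) d))"
      using False sum_greedy_count_Suc[of p n M]
      by (simp flip: of_nat_sum del: greedy_count.simps)
    finally show ?thesis .
  qed
qed simp

text \<open>From the bound for the sum up to \<open>d\<close>, the upper bounds of the
  \<open>d\<close> smaller digits are subtracted; each may be ahead by 1, whence the error
  \<open>d\<close>.\<close>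

lemma greedy_count_lower: "real n * p d - real d \<le> real (greedy_count p n d)"
proof -
  have "real n * (\<Sum>e<Suc d. p e) \<le> (\<Sum>e<Suc d. real (greedy_count p n e))"
    by (rule sum_greedy_count_lower)
  also have "\<dots> = (\<Sum>e<d. real (greedy_count p n e)) + real (greedy_count p n d)"
    by simp
  also have "(\<Sum>e<d. real (greedy_count p n e)) \<le> (\<Sum>e<d. real n * p e + 1)"
    by (rule sum_mono) (rule greedy_count_upper)
  also have "\<dots> = real n * (\<Sum>e<d. p e) + real d"
    by (simp add: sum.distrib sum_distrib_left)
  finally show ?thesis
    by (simp add: algebra_simps)
qed

lemma greedy_count_tendsto: "(\<lambda>n. real (greedy_count p n d) / real n) \<longlonglongrightarrow> p d"
proof (rule tendsto_sandwich)
  show "\<forall>\<^sub>F n in sequentially. p d - real d / real n \<le> real (greedy_count p n d) / real n"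
    using eventually_gt_at_top[of 0]
  proof eventually_elim
    case (elim n)
    then show ?case
      using divide_right_mono[OF greedy_count_lower[of n d], of "real n"]
      by (simp add: diff_divide_distrib)
  qed
  show "\<forall>\<^sub>F n in sequentially. real (greedy_count p n d) / real n \<le> p d + 1 / real n"
    using eventually_gt_at_top[of 0]
  proof eventually_elim
    case (elim n)
    then show ?case
      using divide_right_mono[OF greedy_count_upper[of n d], of "real n"]
      by (simp add: add_divide_distrib)
  qed
  show "(\<lambda>n. p d - real d / real n) \<longlonglongrightarrow> p d"
    using tendsto_diff[OF tendsto_const lim_const_over_n] by fastforce
  show "(\<lambda>n. p d + 1 / real n) \<longlonglongrightarrow> p d"
    using tendsto_add[OF tendsto_const lim_const_over_n] by fastforce
qed

end

section \<open>Prescribed frequencies over a countable set\<close>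

lemma exists_sequence_with_frequencies:
  fixes p :: "'d \<Rightarrow> real"
  assumes "countable D" and "frequency_vector D p"
  shows "\<exists>x. (\<forall>k. x k \<in> D) \<and> (\<forall>d\<in>D. has_frequency x d (p d))"
proof -
  let ?e = "to_nat_on D" and ?i = "from_nat_into D"
  have inj: "inj_on ?e D"
    using assms(1) by (rule inj_on_to_nat_on)
  \<comment> \<open>Weight 0 off the codes keeps the total equal to 1 and, by
    \<open>greedy_seq_pos\<close>, excludes these numbers from the sequence.\<close>
  define q where "q m = (if m \<in> ?e ` D then p (?i m) else 0)" for m
  have q: "q (?e d) = p d" if "d \<in> D" for d
    using that assms(1) by (simp add: q_def)
  have nonneg: "0 \<le> q m" for m
    using assms by (auto simp: q_def frequency_vector_def)
  have "(p has_sum 1) D"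
    using assms(2) by (simp add: frequency_vector_def)
  then have "((q \<circ> ?e) has_sum 1) D"
    by (rule has_sum_cong[THEN iffD1, rotated]) (simp add: q)
  then have "(q has_sum 1) (?e ` D)"
    using has_sum_reindex[OF inj] by blast
  then have "(q has_sum 1) UNIV"
    by (rule has_sum_cong_neutral[THEN iffD1, rotated -1]) (auto simp: q_def)
  then have sums: "q sums 1"
    by (rule has_sum_imp_sums)
  \<comment> \<open>Frequencies are counted from position 1, whereas \<open>greedy_seq\<close>
    starts at 0.\<close>
  define x where "x k = ?i (greedy_seq q (k - 1))" for k
  have range: "greedy_seq q k \<in> ?e ` D" for k
    using greedy_seq_pos[OF nonneg sums, of k] by (auto simp: q_def split: if_splits)
  have "has_frequency x d (p d)" if d: "d \<in> D" for d
  proof -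
    have "card {k. 1 \<le> k \<and> k \<le> n \<and> x k = d} = greedy_count q n (?e d)" for n
    proof -
      have "x (Suc k) = d \<longleftrightarrow> greedy_seq q k = ?e d" for k
        using range[of k] d assms(1) inj by (auto simp: x_def)
      then have "{k. 1 \<le> k \<and> k \<le> n \<and> x k = d} = Suc ` {k. k < n \<and> greedy_seq q k = ?e d}"
        by (auto simp: image_iff Suc_le_eq gr0_conv_Suc) (metis Suc_less_eq less_Suc_eq_le)
      then show ?thesis
        by (simp add: card_image greedy_count_eq_card)
    qed
    then show ?thesis
      using greedy_count_tendsto[OF nonneg sums, of "?e d"] by (simp add: has_frequency_def q d)
  qed
  moreover have "x k \<in> D" for k
    using range[of "k - 1"] assms(1) by (auto simp: x_def)
  ultimately show ?thesis by blast
qed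

section \<open>From digit frequencies to symbol frequencies\<close>

text \<open>Since the total is 1, an excess of one term must be paid for by the others, and these
  cannot fall noticeably below their bounds.\<close>

lemma tendsto_of_eventually_lower_bounds:
  fixes g :: "'s \<Rightarrow> nat \<Rightarrow> real"
  assumes "finite S" and "s \<in> S" and "sum a S = 1"
    and lower: "\<And>t r. t \<in> S \<Longrightarrow> r < a t \<Longrightarrow> \<forall>\<^sub>F n in sequentially. r < g t n"
    and total: "\<forall>\<^sub>F n in sequentially. (\<Sum>t\<in>S. g t n) = 1"
  shows "g s \<longlonglongrightarrow> a s"
proof (rule order_tendstoI)
  show "\<forall>\<^sub>F n in sequentially. r < g s n" if "r < a s" for r
    using lower[OF assms(2) that] .
  fix r assume r: "a s < r"
  \<comment> \<open>The gap is cut into \<open>card S\<close> equal shares: the other terms lose at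
    most \<open>card S - 1\<close> of them, and the last one makes the inequality strict.\<close>
  define \<epsilon> where "\<epsilon> = (r - a s) / real (card S)"
  have card: "0 < card S"
    using assms(1,2) by (auto simp: card_gt_0_iff)
  then have "0 < \<epsilon>"
    using r by (simp add: \<epsilon>_def)
  then have "\<forall>\<^sub>F n in sequentially. \<forall>t\<in>S. a t - \<epsilon> < g t n"
    using assms(1) by (intro eventually_ball_finite ballI lower) auto
  with total show "\<forall>\<^sub>F n in sequentially. g s n < r"
  proof eventually_elim
    case (elim n)
    have "(\<Sum>t\<in>S - {s}. a t - \<epsilon>) \<le> (\<Sum>t\<in>S - {s}. g t n)"
      using elim(2) by (intro sum_mono) (auto intro: less_imp_le)
    moreover have "(\<Sum>t\<in>S - {s}. a t - \<epsilon>) = 1 - a s - (real (card S) - 1) * \<epsilon>"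
      using assms(1-3) card by (simp add: sum_subtractf sum_diff1 of_nat_diff Suc_le_eq)
    moreover have "(\<Sum>t\<in>S - {s}. g t n) = 1 - g s n"
      using assms(1,2) elim(1) by (simp add: sum_diff1)
    moreover have "real (card S) * \<epsilon> = r - a s"
      using card by (simp add: \<epsilon>_def)
    ultimately show ?case
      using \<open>0 < \<epsilon>\<close> by (simp add: algebra_simps)
  qed
qed

text \<open>Summability on each fibre is inherited from the whole digit set, so
  \<open>symbol_weight\<close> is a genuine sum and not the default value of
  \<open>infsum\<close>.\<close>

lemma
  assumes "frequency_vector (digits S B) \<alpha>" and "s \<in> S"
  shows has_sum_symbol_weight: "((\<lambda>b. \<alpha> (s, b)) has_sum symbol_weight B \<alpha> s) (B s)"
    and symbol_weight_nonneg: "0 \<le> symbol_weight B \<alpha> s"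
proof -
  have "\<alpha> summable_on (SIGMA s:S. B s)"
    using assms(1) by (auto simp: frequency_vector_def digits_def summable_on_def)
  then have "\<alpha> summable_on (Pair s ` B s)"
    by (rule summable_on_subset_banach) (use assms(2) in auto)
  then have "(\<alpha> \<circ> Pair s) summable_on B s"
    by (subst (asm) summable_on_reindex) (auto simp: inj_on_def)
  then show "((\<lambda>b. \<alpha> (s, b)) has_sum symbol_weight B \<alpha> s) (B s)"
    unfolding symbol_weight_def by (simp add: o_def has_sum_infsum)
  show "0 \<le> symbol_weight B \<alpha> s"
    unfolding symbol_weight_def
    using assms by (intro infsum_nonneg) (auto simp: frequency_vector_def digits_def)
qed

lemma frequency_vector_symbol_weight:
  assumes "frequency_vector (digits S B) \<alpha>"
  shows "frequency_vector S (symbol_weight B \<alpha>)"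
proof -
  have "(\<alpha> has_sum 1) (SIGMA s:S. B s)"
    using assms by (simp add: frequency_vector_def digits_def)
  then have "(symbol_weight B \<alpha> has_sum 1) S"
    by (rule has_sum_SigmaD) (rule has_sum_symbol_weight[OF assms])
  then show ?thesis
    using symbol_weight_nonneg[OF assms] by (simp add: frequency_vector_def)
qed

text \<open>With infinitely many branches the digit limits cannot simply be added. Finite sets of
  branches still give lower bounds, which suffice because the symbol frequencies add up to
  1.\<close>

lemma symbol_frequency_of_digit_frequencies:
  assumes "finite S" and \<alpha>: "frequency_vector (digits S B) \<alpha>"
    and \<omega>: "\<omega> \<in> symbol_seqs S" and "s \<in> S"
    and freq: "\<And>d. d \<in> digits S B \<Longrightarrow> has_frequency (\<lambda>k. (\<omega> k, b k)) d (\<alpha> d)"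
  shows "has_frequency \<omega> s (symbol_weight B \<alpha> s)"
proof -
  let ?N = "\<lambda>t n. real (card {k. 1 \<le> k \<and> k \<le> n \<and> \<omega> k = t})"
  have fin: "finite {k. 1 \<le> k \<and> k \<le> (n::nat) \<and> P k}" for n P
    by (rule finite_subset[of _ "{..n}"]) auto
  have "(\<lambda>n. ?N s n / real n) \<longlonglongrightarrow> symbol_weight B \<alpha> s"
  proof (rule tendsto_of_eventually_lower_bounds[of S s "symbol_weight B \<alpha>" "\<lambda>t n. ?N t n / real n"])
    show "sum (symbol_weight B \<alpha>) S = 1"
      using frequency_vector_symbol_weight[OF \<alpha>] assms(1)
      by (simp add: frequency_vector_def has_sum_finite_iff)
  next
    fix t r assume t: "t \<in> S" and "r < symbol_weight B \<alpha> t"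
    then have "\<forall>\<^sub>F F in finite_subsets_at_top (B t). r < (\<Sum>b\<in>F. \<alpha> (t, b))"
      using has_sum_symbol_weight[OF \<alpha> t] unfolding has_sum_def by (blast dest: order_tendstoD(1))
    \<comment> \<open>Finitely many branches already carry weight above \<open>r\<close>, and a
      finite sum commutes with the limit.\<close>
    then obtain F where F: "finite F" "F \<subseteq> B t" and r: "r < (\<Sum>b\<in>F. \<alpha> (t, b))"
      unfolding eventually_finite_subsets_at_top by blast
    let ?C = "\<lambda>c n. {k. 1 \<le> k \<and> k \<le> n \<and> (\<omega> k, b k) = (t, c)}"
    have "(\<lambda>n. \<Sum>c\<in>F. real (card (?C c n)) / real n) \<longlonglongrightarrow> (\<Sum>c\<in>F. \<alpha> (t, c))"
      using freq F t by (intro tendsto_sum) (auto simp: has_frequency_def digits_def)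
    then have "\<forall>\<^sub>F n in sequentially. r < (\<Sum>c\<in>F. real (card (?C c n)) / real n)"
      using r by (rule order_tendstoD(1))
    then show "\<forall>\<^sub>F n in sequentially. r < ?N t n / real n"
    proof eventually_elim
      case (elim n)
      have "(\<Sum>c\<in>F. card (?C c n)) = card (\<Union>c\<in>F. ?C c n)"
        using F by (intro card_UN_disjoint[symmetric]) (auto simp: fin)
      also have "\<dots> \<le> card {k. 1 \<le> k \<and> k \<le> n \<and> \<omega> k = t}"
        by (rule card_mono[OF fin]) auto
      finally have "(\<Sum>c\<in>F. real (card (?C c n))) \<le> ?N t n"
        by (simp flip: of_nat_sum)
      then have "(\<Sum>c\<in>F. real (card (?C c n)) / real n) \<le> ?N t n / real n"
        by (simp add: divide_right_mono flip: sum_divide_distrib)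
      with elim show ?case by simp
    qed
  next
    show "\<forall>\<^sub>F n in sequentially. (\<Sum>t\<in>S. ?N t n / real n) = 1"
      using eventually_gt_at_top[of 0]
    proof eventually_elim
      case (elim n)
      have "(\<Sum>t\<in>S. card {k. 1 \<le> k \<and> k \<le> n \<and> \<omega> k = t}) =
          card (\<Union>t\<in>S. {k. 1 \<le> k \<and> k \<le> n \<and> \<omega> k = t})"
        using assms(1) by (intro card_UN_disjoint[symmetric]) (auto simp: fin)
      also have "(\<Union>t\<in>S. {k. 1 \<le> k \<and> k \<le> n \<and> \<omega> k = t}) = {1..n}"
        using \<omega> by (auto simp: symbol_seqs_def PiE_iff)
      finally have "(\<Sum>t\<in>S. ?N t n) = real n"
        by (simp flip: of_nat_sum)
      with elim show ?case
        by (simp flip: sum_divide_distrib)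
    qed
  qed (use assms in auto)
  then show ?thesis by (simp add: has_frequency_def)
qed

section \<open>From symbol frequencies to digit frequencies\<close>

text \<open>The branches at the positions carrying the symbol \<open>s\<close> are read off successively from a
  sequence in \<open>B s\<close> with frequencies \<open>\<alpha> (s, b) / \<alpha>\<^sub>s\<close>.\<close>

lemma freq_branch_seqs_nonempty:
  assumes \<alpha>: "frequency_vector (digits S B) \<alpha>"
    and pos: "\<And>s. s \<in> S \<Longrightarrow> 0 < symbol_weight B \<alpha> s"
    and \<omega>: "\<omega> \<in> symbol_seqs S"
    and freq: "\<And>s. s \<in> S \<Longrightarrow> has_frequency \<omega> s (symbol_weight B \<alpha> s)"
  shows "freq_branch_seqs S B \<alpha> \<omega> \<noteq> {}"
proof -
  have "\<exists>x. (\<forall>k. x k \<in> B s) \<and> (\<forall>b\<in>B s. has_frequency x b (\<alpha> (s, b) / symbol_weight B \<alpha> s))"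
    if s: "s \<in> S" for s
  proof (rule exists_sequence_with_frequencies)
    have "((\<lambda>b. \<alpha> (s, b) / symbol_weight B \<alpha> s) has_sum
        symbol_weight B \<alpha> s / symbol_weight B \<alpha> s) (B s)"
      unfolding divide_inverse by (intro has_sum_cmult_left has_sum_symbol_weight[OF \<alpha> s])
    moreover have "0 \<le> \<alpha> (s, b)" if "b \<in> B s" for b
      using \<alpha> s that by (auto simp: frequency_vector_def digits_def)
    ultimately show "frequency_vector (B s) (\<lambda>b. \<alpha> (s, b) / symbol_weight B \<alpha> s)"
      using pos[OF s] by (auto simp: frequency_vector_def)
  qed simp
  then obtain x where x: "\<And>s k. s \<in> S \<Longrightarrow> x s k \<in> B s"
    and xfreq: "\<And>s b. s \<in> S \<Longrightarrow> b \<in> B s \<Longrightarrow>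
      has_frequency (x s) b (\<alpha> (s, b) / symbol_weight B \<alpha> s)"
    by metis
  define N where "N s n = card {k. 1 \<le> k \<and> k \<le> n \<and> \<omega> k = s}" for s n
  \<comment> \<open>\<open>N (\<omega> k) k\<close> counts position \<open>k\<close> itself, so it
    is the rank of \<open>k\<close>, starting at 1, among the positions with its symbol.\<close>
  define b where "b = restrict (\<lambda>k. x (\<omega> k) (N (\<omega> k) k)) {1..}"
  have set_Suc: "{k. 1 \<le> k \<and> k \<le> Suc n \<and> P k} =
      (if P (Suc n) then insert (Suc n) {k. 1 \<le> k \<and> k \<le> n \<and> P k}
       else {k. 1 \<le> k \<and> k \<le> n \<and> P k})" for n P
    by (auto simp: le_Suc_eq)
  have fin: "finite {k. 1 \<le> k \<and> k \<le> (n::nat) \<and> P k}" for n P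
    by (rule finite_subset[of _ "{..n}"]) auto
  have card_Suc: "card {k. 1 \<le> k \<and> k \<le> Suc n \<and> P k} =
      card {k. 1 \<le> k \<and> k \<le> n \<and> P k} + (if P (Suc n) then 1 else 0)" for n P
    unfolding set_Suc using fin by simp
  \<comment> \<open>Each occurrence of \<open>s\<close> consumes exactly one term of
    \<open>x s\<close>.\<close>
  have card_b: "card {k. 1 \<le> k \<and> k \<le> n \<and> (\<omega> k, b k) = (s, c)} =
      card {j. 1 \<le> j \<and> j \<le> N s n \<and> x s j = c}" for s c n
  proof (induction n)
    case 0
    have no_index: "{k. 1 \<le> k \<and> k \<le> (0::nat) \<and> P k} = {}" for P by auto
    show ?case by (simp only: N_def no_index card.empty)
  next
    case (Suc n)
    have "N s (Suc n) = N s n + (if \<omega> (Suc n) = s then 1 else 0)"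
      unfolding N_def by (rule card_Suc)
    moreover have "b (Suc n) = x (\<omega> (Suc n)) (N (\<omega> (Suc n)) (Suc n))"
      by (simp add: b_def)
    ultimately show ?case
      using Suc by (auto simp: card_Suc[unfolded One_nat_def])
  qed
  have "has_frequency (\<lambda>k. (\<omega> k, b k)) (s, c) (\<alpha> (s, c))" if s: "s \<in> S" and c: "c \<in> B s" for s c
  proof -
    let ?w = "symbol_weight B \<alpha> s"
    have Nlim: "(\<lambda>n. real (N s n) / real n) \<longlonglongrightarrow> ?w"
      using freq[OF s] by (simp add: has_frequency_def N_def)
    \<comment> \<open>Positive weight makes \<open>s\<close> occur infinitely often, so the limit
      for \<open>x s\<close> may be taken along \<open>N s\<close>.\<close>
    have "filterlim (\<lambda>n. real (N s n) / real n * real n) at_top sequentially"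
      using Nlim pos[OF s] filterlim_real_sequentially by (rule filterlim_tendsto_pos_mult_at_top)
    moreover have "\<forall>\<^sub>F n in sequentially. real (N s n) / real n * real n = real (N s n)"
      using eventually_gt_at_top[of 0] by eventually_elim simp
    ultimately have "filterlim (\<lambda>n. real (N s n)) at_top sequentially"
      by (simp cong: filterlim_cong)
    then have Ntop: "filterlim (N s) at_top sequentially"
      by (simp add: filterlim_sequentially_iff_filterlim_real)
    let ?C = "\<lambda>m. real (card {j. 1 \<le> j \<and> j \<le> m \<and> x s j = c})"
    have "(\<lambda>m. ?C m / real m) \<longlonglongrightarrow> \<alpha> (s, c) / ?w"
      using xfreq[OF s c] by (simp add: has_frequency_def)
    then have "(\<lambda>n. ?C (N s n) / real (N s n)) \<longlonglongrightarrow> \<alpha> (s, c) / ?w"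
      using Ntop by (rule filterlim_compose)
    from tendsto_mult[OF this Nlim]
    have "(\<lambda>n. ?C (N s n) / real (N s n) * (real (N s n) / real n)) \<longlonglongrightarrow> \<alpha> (s, c)"
      using pos[OF s] by simp
    \<comment> \<open>If \<open>N s n = 0\<close>, both sides vanish: division by 0 gives 0 and the
      count is empty.\<close>
    moreover have "?C (N s n) / real (N s n) * (real (N s n) / real n) = ?C (N s n) / real n" for n
      by (cases "N s n = 0") auto
    ultimately show ?thesis
      unfolding has_frequency_def card_b by (simp only:)
  qed
  moreover have "b \<in> branch_seqs B \<omega>"
    using \<omega> x by (auto simp: b_def branch_seqs_def symbol_seqs_def PiE_iff)
  ultimately have "b \<in> freq_branch_seqs S B \<alpha> \<omega>"
    by (auto simp: freq_branch_seqs_def digits_def)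
  then show ?thesis by blast
qed

theorem theorem1p2:
  fixes S :: "'s set"
    and B :: "'s \<Rightarrow> nat set"
    and f :: "'s \<Rightarrow> nat \<Rightarrow> real \<Rightarrow> real"
    and \<alpha> :: "'s \<times> nat \<Rightarrow> real"
  assumes "finite S"
    and "\<And>s. s \<in> S \<Longrightarrow> GLS_IFS (B s) (f s)"
    and "frequency_vector (digits S B) \<alpha>"
    and "\<And>s. s \<in> S \<Longrightarrow> \<exists>b\<in>B s. \<alpha> (s, b) > 0"
  shows "Omega S B f \<alpha> =
           {\<omega> \<in> symbol_seqs S. \<forall>s\<in>S. has_frequency \<omega> s (symbol_weight B \<alpha> s)}
         \<and> Omega S B f \<alpha> \<noteq> {}"
proof -
  let ?R = "{\<omega> \<in> symbol_seqs S. \<forall>s\<in>S. has_frequency \<omega> s (symbol_weight B \<alpha> s)}"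
  have pos: "0 < symbol_weight B \<alpha> s" if s: "s \<in> S" for s
  proof -
    obtain b where b: "b \<in> B s" "0 < \<alpha> (s, b)"
      using assms(4)[OF s] by blast
    have "(\<Sum>c\<in>{b}. \<alpha> (s, c)) \<le> symbol_weight B \<alpha> s"
    proof (rule finite_sum_le_has_sum[OF has_sum_symbol_weight[OF assms(3) s]])
      show "0 \<le> \<alpha> (s, c)" if "c \<in> B s - {b}" for c
        using assms(3) s that by (auto simp: frequency_vector_def digits_def)
    qed (use b in auto)
    with b show ?thesis by simp
  qed
  have eq: "Omega S B f \<alpha> = ?R"
  proof (intro equalityI subsetI)
    fix \<omega> assume "\<omega> \<in> Omega S B f \<alpha>"
    then obtain b where "\<omega> \<in> symbol_seqs S" "b \<in> freq_branch_seqs S B \<alpha> \<omega>"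
      by (auto simp: Omega_def freq_set_def)
    then show "\<omega> \<in> ?R"
      using symbol_frequency_of_digit_frequencies[OF assms(1,3)]
      by (auto simp: freq_branch_seqs_def)
  next
    fix \<omega> assume "\<omega> \<in> ?R"
    then show "\<omega> \<in> Omega S B f \<alpha>"
      using freq_branch_seqs_nonempty[OF assms(3) pos, of \<omega>]
      by (auto simp: Omega_def freq_set_def)
  qed
  \<comment> \<open>Nonemptiness: the greedy construction is applied once more, now to the symbol
    weights on \<open>S\<close>.\<close>
  obtain x where x: "\<And>k. x k \<in> S" "\<And>s. s \<in> S \<Longrightarrow> has_frequency x s (symbol_weight B \<alpha> s)"
    using exists_sequence_with_frequencies[OF countable_finite[OF assms(1)]
        frequency_vector_symbol_weight[OF assms(3)]] by blast
  \<comment> \<open>Elements of \<open>symbol_seqs S\<close> are extensional; restricting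
    \<open>x\<close> leaves all counts unchanged, as they start at 1.\<close>
  have "{k. 1 \<le> k \<and> k \<le> n \<and> restrict x {1..} k = s} = {k. 1 \<le> k \<and> k \<le> n \<and> x k = s}" for n s
    by auto
  then have "restrict x {1..} \<in> ?R"
    using x by (auto simp: has_frequency_def symbol_seqs_def simp del: restrict_apply)
  with eq show ?thesis by blast
qed

end
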